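(* Let $a\in\mathbb{R}$ (the frozen value of $\nabla^2F$) and let $s\in\mathbb{R}$ denote the step size. For $n\geq 1$ let $$P_n=\begin{pmatrix}\frac{10n^2+9n+6}{4n^2+8n}-\frac{2n-3}{2n+4}sa & -\left(\frac{4n^2+3}{2n^2+4n}-\frac{n-3}{2n+4}sa\right) & \frac{2n-1}{4n+8}\\ 1&0&0\\ 0&1&0\end{pmatrix},\qquad Q_n=\begin{pmatrix}\frac{2n-3}{n}(1-sa) & -\frac{n-3}{n}(1-sa)\\ 1&0\end{pmatrix}$$ be the linearized error-propagation matrices of SAG and NAG respectively. Then, as $n\to\infty$, the characteristic equations of $P_n$ and $Q_n$ become (coefficientwise) respectively $$\lambda^3-\left(\frac52-sa\right)\lambda^2+\left(2-\frac{sa}{2}\right)\lambda-\frac12=0\qquad\text{(SAG)},$$ $$\lambda^2-(2-2sa)\lambda+(1-sa)=0\qquad\text{(NAG)}.$$ Moreover, the absolutely stable region of SAG is $\{s: sa\in[0,4]\}$, and the absolutely stable region of NAG is $\{s: sa\in[0,\frac43]\}$.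
   Context: SAG (stabilized accelerated gradient) with step size $s$ is the recurrence $x_{n+1}=\frac{10n^2+9n+6}{4n^2+8n}x_n-\frac{4n^2+3}{2n^2+4n}x_{n-1}+\frac{2n-1}{4n+8}x_{n-2}-\frac{n}{2n+4}s\nabla F\left(\frac{2n-3}{n}x_n-\frac{n-3}{n}x_{n-1}\right)$. NAG (Nesterov's accelerated gradient) with step size $s$ is $x_{n+1}=y_n-s\nabla F(y_n)$ with $y_n=x_n+\frac{n-3}{n}(x_n-x_{n-1})$. The linearized error-propagation matrix is obtained by replacing $\nabla F$ by its first-order Taylor approximation around the exact argument, with the Hessian $\nabla^2F$ treated as a scalar constant $a$; it maps the error vector of $(x_n,x_{n-1},x_{n-2})$ (resp. $(x_n,x_{n-1})$) to that of the next iterate vector. The characteristic equation of the method is the limit, as $n\to\infty$, of the characteristic equation of this matrix (terms vanishing for large $n$ are dropped). The absolutely stable region of a method is the set of step sizes $s$ for which all complex roots of the method's characteristic equation lie in the closed unit disc $\{|\lambda|\le1\}$. *)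

theory Defs
  imports "HOL-Analysis.Euclidean_Space" "Jordan_Normal_Form.Char_Poly"
begin

text \<open>
  A window \<open>X :: nat \<Rightarrow> 'v\<close> stores the current and the previous iterates, \<open>X j\<close> being
  \<open>x\<^sub>n\<^sub>-\<^sub>j\<close>; only finitely many entries are relevant for a given method.  The parameter
  \<open>G\<close> of an update rule is the gradient field; the index \<open>n\<close> is cast to a real number
  before subtracting, so \<open>n - 3\<close> may be negative.
\<close>

definition sag_point :: "nat \<Rightarrow> (nat \<Rightarrow> 'v::euclidean_space) \<Rightarrow> 'v" where
  "sag_point n X = ((2 * real n - 3) / real n) *\<^sub>R X 0 - ((real n - 3) / real n) *\<^sub>R X 1"

definition sag_step ::
    "real \<Rightarrow> nat \<Rightarrow> ('v \<Rightarrow> 'v) \<Rightarrow> (nat \<Rightarrow> 'v::euclidean_space) \<Rightarrow> 'v" where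
  "sag_step s n G X =
     ((10 * (real n)^2 + 9 * real n + 6) / (4 * (real n)^2 + 8 * real n)) *\<^sub>R X 0
   - ((4 * (real n)^2 + 3) / (2 * (real n)^2 + 4 * real n)) *\<^sub>R X 1
   + ((2 * real n - 1) / (4 * real n + 8)) *\<^sub>R X 2
   - ((real n / (2 * real n + 4)) * s) *\<^sub>R G (sag_point n X)"

definition nag_point :: "nat \<Rightarrow> (nat \<Rightarrow> 'v::euclidean_space) \<Rightarrow> 'v" where
  "nag_point n X = X 0 + ((real n - 3) / real n) *\<^sub>R (X 0 - X 1)"

definition nag_step ::
    "real \<Rightarrow> nat \<Rightarrow> ('v \<Rightarrow> 'v) \<Rightarrow> (nat \<Rightarrow> 'v::euclidean_space) \<Rightarrow> 'v" where
  "nag_step s n G X = nag_point n X - s *\<^sub>R G (nag_point n X)"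

text \<open>
  First-order Taylor approximation of the gradient field \<open>G\<close> around \<open>y\<^sub>0\<close>, where the Hessian is
  replaced by the scalar \<open>a\<close>.
\<close>

definition frozen_taylor ::
    "('v \<Rightarrow> 'v) \<Rightarrow> real \<Rightarrow> 'v \<Rightarrow> 'v::euclidean_space \<Rightarrow> 'v" where
  "frozen_taylor G a y0 y = G y0 + a *\<^sub>R (y - y0)"

definition shift_window :: "((nat \<Rightarrow> 'v) \<Rightarrow> 'v) \<Rightarrow> (nat \<Rightarrow> 'v) \<Rightarrow> nat \<Rightarrow> 'v" where
  "shift_window step X = case_nat (step X) X"

text \<open>
  \<open>M\<close> propagates the error of the last \<open>k\<close> iterates: \<open>X\<close> is the exact window, \<open>E\<close> its error, and
  in the perturbed step the gradient is linearized around the exact evaluation point.  The entries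
  of \<open>M\<close> act as scalars on the errors, which are vectors.
\<close>

definition is_error_matrix ::
    "nat \<Rightarrow> (('v \<Rightarrow> 'v) \<Rightarrow> (nat \<Rightarrow> 'v) \<Rightarrow> 'v) \<Rightarrow> ((nat \<Rightarrow> 'v) \<Rightarrow> 'v) \<Rightarrow>
     ('v::euclidean_space \<Rightarrow> 'v) \<Rightarrow> real \<Rightarrow> real mat \<Rightarrow> bool" where
  "is_error_matrix k step point G a M \<longleftrightarrow>
     M \<in> carrier_mat k k \<and>
     (\<forall>X E :: nat \<Rightarrow> 'v. \<forall>i<k.
        shift_window (step (frozen_taylor G a (point X))) (\<lambda>j. X j + E j) i
          - shift_window (step G) X i
        = (\<Sum>j<k. (M $$ (i, j)) *\<^sub>R E j))"

definition sag_matrix :: "real \<Rightarrow> real \<Rightarrow> nat \<Rightarrow> real mat" where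
  "sag_matrix a s n = mat_of_rows_list 3
     [[(10 * (real n)^2 + 9 * real n + 6) / (4 * (real n)^2 + 8 * real n)
         - (2 * real n - 3) / (2 * real n + 4) * s * a,
       - ((4 * (real n)^2 + 3) / (2 * (real n)^2 + 4 * real n)
           - (real n - 3) / (2 * real n + 4) * s * a),
       (2 * real n - 1) / (4 * real n + 8)],
      [1, 0, 0],
      [0, 1, 0]]"

definition nag_matrix :: "real \<Rightarrow> real \<Rightarrow> nat \<Rightarrow> real mat" where
  "nag_matrix a s n = mat_of_rows_list 2
     [[(2 * real n - 3) / real n * (1 - s * a), - ((real n - 3) / real n * (1 - s * a))],
      [1, 0]]"

definition limit_char_poly :: "(nat \<Rightarrow> real mat) \<Rightarrow> real poly \<Rightarrow> bool" where
  "limit_char_poly M p \<longleftrightarrow> (\<forall>k. (\<lambda>n. coeff (char_poly (M n)) k) \<longlonglongrightarrow> coeff p k)"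

text \<open>
  The family \<open>M s n\<close> of error matrices represents the method with step size \<open>s\<close>.  The limit
  polynomial \<open>p\<close> is unique if it exists, since its coefficients are limits of real sequences.
\<close>

definition absolutely_stable_region :: "(real \<Rightarrow> nat \<Rightarrow> real mat) \<Rightarrow> real set" where
  "absolutely_stable_region M =
     {s. \<exists>p. limit_char_poly (M s) p \<and>
             (\<forall>z::complex. poly (map_poly of_real p) z = 0 \<longrightarrow> cmod z \<le> 1)}"

end

theory Submission
  imports Defs "HOL-Real_Asymp.Real_Asymp"
begin

text \<open>
  With \<open>t = s * a\<close>, the limiting SAG polynomial has the root \<open>1/2\<close> for every \<open>t\<close>; its cofactor
  \<open>z\<^sup>2 - (2 - t) z + 1\<close> and the limiting NAG polynomial are real quadratics, to which the
  Schur--Cohn criterion for the closed disc applies: the roots of \<open>z\<^sup>2 - b z + c\<close> have modulus at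
  most \<open>1\<close> iff \<open>c \<le> 1\<close> and \<open>\<bar>b\<bar> \<le> 1 + c\<close>.
\<close>

section \<open>Error-propagation matrices\<close>

text \<open>An error window holding a nonzero vector in slot \<open>j\<close> and zeros elsewhere
  isolates column \<open>j\<close>. Such a vector exists because a Euclidean space has a nonempty
  basis.\<close>

lemma is_error_matrix_unique:
  fixes G :: "'v::euclidean_space \<Rightarrow> 'v"
  assumes "is_error_matrix k step point G a M" and "is_error_matrix k step point G a N"
  shows "M = N"
proof (rule eq_matI)
  have dims: "M \<in> carrier_mat k k" "N \<in> carrier_mat k k"
    using assms by (auto simp: is_error_matrix_def)
  then show "dim_row M = dim_row N" "dim_col M = dim_col N" by auto
  obtain v :: 'v where v: "v \<in> Basis" using nonempty_Basis by blast
  fix i j assume "i < dim_row N" "j < dim_col N"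
  with dims have ij: "i < k" "j < k" by auto
  define E where "E l = (if l = j then v else 0)" for l :: nat
  have sum_E: "(\<Sum>l<k. (A $$ (i, l)) *\<^sub>R E l) = (A $$ (i, j)) *\<^sub>R v" for A :: "real mat"
    using ij by (simp add: E_def if_distrib[of "scaleR _"] cong: if_cong)
  have "(\<Sum>l<k. (M $$ (i, l)) *\<^sub>R E l) = (\<Sum>l<k. (N $$ (i, l)) *\<^sub>R E l)"
    using assms ij unfolding is_error_matrix_def
    by (elim conjE allE[of _ "\<lambda>_. 0"] allE[of _ E] allE[of _ i]) (simp only: simp_thms)
  then show "M $$ (i, j) = N $$ (i, j)"
    using v by (auto simp: sum_E)
qed

text \<open>Both evaluations contain the same value of \<open>G\<close> at the exact point, which
  cancels in the difference. What remains is linear in \<open>E\<close>, since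
  \<open>sag_point\<close> is linear in the window. The lower rows only shift the window.\<close>

lemma sag_matrix_is_error_matrix:
  assumes "n \<ge> 1"
  shows "is_error_matrix 3 (sag_step s n) (sag_point n) G a (sag_matrix a s n)"
  unfolding is_error_matrix_def
proof (intro conjI allI impI)
  show "sag_matrix a s n \<in> carrier_mat 3 3"
    by (intro carrier_matI) (simp_all add: sag_matrix_def mat_of_rows_list_def)
  fix X E :: "nat \<Rightarrow> 'a" and i :: nat
  assume "i < 3"
  define c where "c = real n / (2 * real n + 4)"
  define p where "p = (2 * real n - 3) / real n"
  define q where "q = (real n - 3) / real n"
  \<comment> \<open>Here \<open>n\<close> is cancelled, which requires \<open>n \<ge> 1\<close>. All
    coefficients are then named, so that the simplifier treats them as atoms and has no fractions to
    combine.\<close>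
  have cp: "(2 * real n - 3) / (2 * real n + 4) = c * p"
    and cq: "(real n - 3) / (2 * real n + 4) = c * q"
    using assms by (auto simp: c_def p_def q_def)
  define u where "u = (10 * (real n)^2 + 9 * real n + 6) / (4 * (real n)^2 + 8 * real n)"
  define v where "v = (4 * (real n)^2 + 3) / (2 * (real n)^2 + 4 * real n)"
  define w where "w = (2 * real n - 1) / (4 * real n + 8)"
  have point: "sag_point n Y = p *\<^sub>R Y 0 - q *\<^sub>R Y 1" for Y :: "nat \<Rightarrow> 'a"
    unfolding sag_point_def p_def q_def ..
  have step: "sag_step s n H Y
      = u *\<^sub>R Y 0 - v *\<^sub>R Y 1 + w *\<^sub>R Y 2 - (c * s) *\<^sub>R H (sag_point n Y)"
    for H and Y :: "nat \<Rightarrow> 'a"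
    unfolding sag_step_def u_def v_def w_def c_def ..
  have matrix: "sag_matrix a s n = mat_of_rows_list 3
      [[u - c * p * s * a, - (v - c * q * s * a), w], [1, 0, 0], [0, 1, 0]]"
    unfolding sag_matrix_def cp cq u_def v_def w_def ..
  consider "i = 0" | "i = 1" | "i = 2" using \<open>i < 3\<close> by linarith
  then show "shift_window (sag_step s n (frozen_taylor G a (sag_point n X))) (\<lambda>j. X j + E j) i
      - shift_window (sag_step s n G) X i = (\<Sum>j<3. (sag_matrix a s n $$ (i, j)) *\<^sub>R E j)"
  proof cases
    case 1
    then show ?thesis
      by (simp add: shift_window_def matrix mat_of_rows_list_def numeral_eq_Suc
          step point frozen_taylor_def algebra_simps)
  next
    case 2
    then show ?thesis
      by (simp add: shift_window_def sag_matrix_def mat_of_rows_list_def numeral_3_eq_3)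
  next
    case 3
    then show ?thesis
      by (simp add: shift_window_def sag_matrix_def mat_of_rows_list_def numeral_eq_Suc)
  qed
qed

lemma nag_matrix_is_error_matrix:
  assumes "n \<ge> 1"
  shows "is_error_matrix 2 (nag_step s n) (nag_point n) G a (nag_matrix a s n)"
  unfolding is_error_matrix_def
proof (intro conjI allI impI)
  show "nag_matrix a s n \<in> carrier_mat 2 2"
    by (intro carrier_matI) (simp_all add: nag_matrix_def mat_of_rows_list_def)
  fix X E :: "nat \<Rightarrow> 'a" and i :: nat
  assume "i < 2"
  define q where "q = (real n - 3) / real n"
  \<comment> \<open>The point is given as a momentum step, the matrix by collected coefficients;
    this identity links the two.\<close>
  have p: "(2 * real n - 3) / real n = 1 + q"
    using assms by (simp add: q_def field_simps)
  consider "i = 0" | "i = 1" using \<open>i < 2\<close> by linarith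
  then show "shift_window (nag_step s n (frozen_taylor G a (nag_point n X))) (\<lambda>j. X j + E j) i
      - shift_window (nag_step s n G) X i = (\<Sum>j<2. (nag_matrix a s n $$ (i, j)) *\<^sub>R E j)"
  proof cases
    case 1
    then show ?thesis
      unfolding nag_matrix_def p
      by (simp add: shift_window_def mat_of_rows_list_def numeral_2_eq_2
          nag_step_def nag_point_def frozen_taylor_def algebra_simps
          flip: q_def)
  next
    case 2
    then show ?thesis
      by (simp add: shift_window_def nag_matrix_def mat_of_rows_list_def numeral_2_eq_2)
  qed
qed

section \<open>Limiting characteristic polynomials\<close>

lemma det_carrier_mat_2:
  fixes A :: "'a::comm_ring_1 mat"
  assumes A: "A \<in> carrier_mat 2 2"
  shows "det A = A $$ (0, 0) * A $$ (1, 1) - A $$ (0, 1) * A $$ (1, 0)"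
  using A by (subst laplace_expansion_row[OF A, of 0])
    (auto simp: numeral_2_eq_2 cofactor_def mat_delete_def det_single)

lemma char_poly_shift_mat_2:
  fixes p q :: "'a::comm_ring_1"
  shows "char_poly (mat_of_rows_list 2 [[p, q], [1, 0]]) = [:- q, - p, 1:]"
    (is "char_poly ?A = _")
proof -
  have "?A \<in> carrier_mat 2 2"
    by (intro carrier_matI) (simp_all add: mat_of_rows_list_def)
  then show ?thesis
    unfolding char_poly_def
    by (subst det_carrier_mat_2) (simp_all add: char_poly_matrix_def mat_of_rows_list_def)
qed

text \<open>This is a companion matrix, so its first row lists the negated lower coefficients.
  Expansion along that row leaves 2x2 minors.\<close>

lemma char_poly_shift_mat_3:
  fixes p q r :: "'a::comm_ring_1"
  shows "char_poly (mat_of_rows_list 3 [[p, q, r], [1, 0, 0], [0, 1, 0]]) = [:- r, - q, - p, 1:]"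
    (is "char_poly ?A = _")
proof -
  have A: "char_poly_matrix ?A \<in> carrier_mat 3 3"
    by (intro char_poly_matrix_closed carrier_matI) (simp_all add: mat_of_rows_list_def)
  have minor: "det (mat_delete (char_poly_matrix ?A) 0 j)
      = (let B = mat_delete (char_poly_matrix ?A) 0 j
         in B $$ (0, 0) * B $$ (1, 1) - B $$ (0, 1) * B $$ (1, 0))" for j
    using mat_delete_carrier[OF A, of 0 j] by (simp add: det_carrier_mat_2 Let_def)
  have "char_poly ?A = (\<Sum>j<3. char_poly_matrix ?A $$ (0, j) * cofactor (char_poly_matrix ?A) 0 j)"
    unfolding char_poly_def by (rule laplace_expansion_row[OF A]) simp
  also have "\<dots> = [:- r, - q, - p, 1:]"
    unfolding cofactor_def minor
    by (simp add: numeral_3_eq_3 mat_delete_def char_poly_matrix_def mat_of_rows_list_def)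
  finally show ?thesis .
qed

lemma sag_limit_char_poly:
  "limit_char_poly (sag_matrix a s) [: - (1/2), 2 - s * a / 2, - (5/2 - s * a), 1 :]"
  unfolding limit_char_poly_def
proof
  fix k :: nat
  consider "k = 0" | "k = 1" | "k = 2" | "k = 3" | "k \<ge> 4" by linarith
  then show "(\<lambda>n. coeff (char_poly (sag_matrix a s n)) k)
      \<longlonglongrightarrow> coeff [: - (1/2), 2 - s * a / 2, - (5/2 - s * a), 1 :] k"
  proof cases
    case 1
    show ?thesis unfolding 1 sag_matrix_def char_poly_shift_mat_3
      by simp real_asymp
  next
    case 2
    show ?thesis unfolding 2 sag_matrix_def char_poly_shift_mat_3
      by simp real_asymp
  next
    case 3
    show ?thesis unfolding 3 sag_matrix_def char_poly_shift_mat_3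
      by (simp add: numeral_2_eq_2) real_asymp
  next
    case 4
    show ?thesis unfolding 4 sag_matrix_def char_poly_shift_mat_3
      by (simp add: numeral_3_eq_3)
  next
    case 5
    then show ?thesis
      unfolding sag_matrix_def char_poly_shift_mat_3
      by (auto simp: coeff_pCons split: nat.split)
  qed
qed

lemma nag_limit_char_poly:
  "limit_char_poly (nag_matrix a s) [: 1 - s * a, - (2 - 2 * s * a), 1 :]"
  unfolding limit_char_poly_def
proof
  fix k :: nat
  consider "k = 0" | "k = 1" | "k = 2" | "k \<ge> 3" by linarith
  then show "(\<lambda>n. coeff (char_poly (nag_matrix a s n)) k)
      \<longlonglongrightarrow> coeff [: 1 - s * a, - (2 - 2 * s * a), 1 :] k"
  proof cases
    case 1
    show ?thesis unfolding 1 nag_matrix_def char_poly_shift_mat_2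
      by simp real_asymp
  next
    case 2
    show ?thesis unfolding 2 nag_matrix_def char_poly_shift_mat_2
      by simp real_asymp
  next
    case 3
    show ?thesis unfolding 3 nag_matrix_def char_poly_shift_mat_2
      by (simp add: numeral_2_eq_2)
  next
    case 4
    then show ?thesis
      unfolding nag_matrix_def char_poly_shift_mat_2
      by (auto simp: coeff_pCons split: nat.split)
  qed
qed

section \<open>Stability and roots of quadratics\<close>

lemma limit_char_poly_unique:
  assumes "limit_char_poly M p" and "limit_char_poly M q"
  shows "p = q"
  using assms unfolding limit_char_poly_def by (intro poly_eqI) (blast intro: LIMSEQ_unique)

text \<open>Uniqueness of the limit polynomial removes the existential quantifier from the
  definition.\<close>

lemma absolutely_stable_region_eq:
  assumes "\<And>s. limit_char_poly (M s) (p s)"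
  shows "absolutely_stable_region M
    = {s. \<forall>z::complex. poly (map_poly of_real (p s)) z = 0 \<longrightarrow> cmod z \<le> 1}"
  using assms limit_char_poly_unique unfolding absolutely_stable_region_def by blast

lemma real_quadratic_roots_in_disc_iff:
  fixes b c :: real
  shows "(\<forall>z::complex. z\<^sup>2 - of_real b * z + of_real c = 0 \<longrightarrow> cmod z \<le> 1)
    \<longleftrightarrow> c \<le> 1 \<and> \<bar>b\<bar> \<le> 1 + c"
    (is "?L \<longleftrightarrow> ?R")
proof
  assume ?L
  then have root: "cmod z \<le> 1" if "z\<^sup>2 - of_real b * z + of_real c = 0" for z :: complex
    using that by blast
  \<comment> \<open>Both roots are built from a complex square root of the discriminant; their
    product \<open>c\<close> then has modulus at most 1.\<close>
  define w where "w = csqrt (of_real (b\<^sup>2 - 4 * c))"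
  define z1 where "z1 = (of_real b + w) / 2"
  define z2 where "z2 = (of_real b - w) / 2"
  have w2: "w\<^sup>2 = (of_real b)\<^sup>2 - 4 * of_real c" by (simp add: w_def)
  have "z1\<^sup>2 - of_real b * z1 + of_real c = (w\<^sup>2 - ((of_real b)\<^sup>2 - 4 * of_real c)) / 4"
    "z2\<^sup>2 - of_real b * z2 + of_real c = (w\<^sup>2 - ((of_real b)\<^sup>2 - 4 * of_real c)) / 4"
    by (simp_all add: z1_def z2_def power2_eq_square field_simps)
  then have z: "cmod z1 \<le> 1" "cmod z2 \<le> 1"
    by (auto intro!: root simp: w2)
  have prod: "z1 * z2 = of_real c"
    using w2 by (simp add: z1_def z2_def power2_eq_square field_simps)
  have "\<bar>c\<bar> = cmod z1 * cmod z2"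
    by (metis norm_mult norm_of_real prod)
  also have "\<dots> \<le> 1" using z by (simp add: mult_le_one)
  finally have c: "\<bar>c\<bar> \<le> 1" .
  have "\<bar>b\<bar> \<le> 1 + c"
  proof (rule ccontr)
    assume "\<not> \<bar>b\<bar> \<le> 1 + c"
    then have b: "\<bar>b\<bar> > 1 + c" by simp
    \<comment> \<open>Squaring is monotone here because \<open>c \<ge> -1\<close>; subtracting
      \<open>4 * c\<close> turns the left side into the square of \<open>1 - c\<close>.\<close>
    have "(1 + c)\<^sup>2 < \<bar>b\<bar>\<^sup>2"
      using b c by (intro power_strict_mono) auto
    then have D: "(1 - c)\<^sup>2 < b\<^sup>2 - 4 * c"
      by (simp add: power2_eq_square algebra_simps)
    define r where "r = sqrt (b\<^sup>2 - 4 * c)"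
    have r: "1 - c < r"
      using D c real_less_rsqrt by (simp add: r_def)
    have r2: "r\<^sup>2 = b\<^sup>2 - 4 * c"
      using D unfolding r_def by (intro real_sqrt_pow2) (smt (verit) zero_le_power2)
    \<comment> \<open>The sign of \<open>r\<close> follows that of \<open>b\<close>, giving the real
      root of larger modulus: |x| = (|b| + r)/2 > ((1 + c) + (1 - c))/2 = 1.\<close>
    define x where "x = (if b \<ge> 0 then (b + r) / 2 else (b - r) / 2)"
    have "x\<^sup>2 - b * x + c = 0"
      using r2 by (simp add: x_def power2_eq_square field_simps)
    then have "complex_of_real (x\<^sup>2 - b * x + c) = 0" by simp
    then have "cmod (of_real x) \<le> 1" by (intro root) simp
    then show False using b r c by (auto simp: x_def split: if_splits)
  qed
  with c show ?R by simp
next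
  assume R: ?R
  show ?L
  proof (intro allI impI)
    fix z :: complex assume z: "z\<^sup>2 - of_real b * z + of_real c = 0"
    define x y where "x = Re z" and "y = Im z"
    have re: "x\<^sup>2 - y\<^sup>2 - b * x + c = 0"
      using arg_cong[OF z, of Re] by (simp add: x_def y_def power2_eq_square)
    have im: "y * (2 * x - b) = 0"
      using arg_cong[OF z, of Im] by (simp add: x_def y_def power2_eq_square algebra_simps)
    show "cmod z \<le> 1"
    proof (cases "y = 0")
      case True
      \<comment> \<open>For a real root this product is at most 0, whereas |x| > 1 \<ge> c would
        make both factors positive.\<close>
      have "(\<bar>x\<bar> - 1) * (\<bar>x\<bar> - c) = x\<^sup>2 - (1 + c) * \<bar>x\<bar> + c"
        by (simp add: power2_eq_square algebra_simps)
      also have "\<dots> \<le> x\<^sup>2 - \<bar>b\<bar> * \<bar>x\<bar> + c"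
        using R by (simp add: mult_right_mono)
      also have "\<dots> \<le> x\<^sup>2 - b * x + c"
        by (simp flip: abs_mult)
      also have "\<dots> = 0" using re True by simp
      finally have "(\<bar>x\<bar> - 1) * (\<bar>x\<bar> - c) \<le> 0" .
      then have "\<bar>x\<bar> \<le> 1"
        using R mult_pos_pos[of "\<bar>x\<bar> - 1" "\<bar>x\<bar> - c"] by linarith
      then show ?thesis
        using True by (simp add: cmod_def x_def y_def)
    next
      case False
      \<comment> \<open>A nonreal root comes with its conjugate, so its squared modulus is the
        product of the roots, \<open>c\<close>.\<close>
      then have "b = 2 * x" using im by simp
      with re have "x\<^sup>2 + y\<^sup>2 = c" by (simp add: power2_eq_square)
      then show ?thesis using R by (simp add: cmod_def x_def y_def)
    qed
  qed
qed

section \<open>The two stable regions\<close>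

lemma sag_stable_region:
  "absolutely_stable_region (sag_matrix a) = {s. s * a \<in> {0..4}}"
proof -
  have "(\<forall>z::complex. poly (map_poly of_real
        [: - (1/2), 2 - s * a / 2, - (5/2 - s * a), 1 :]) z = 0 \<longrightarrow> cmod z \<le> 1)
      \<longleftrightarrow> s * a \<in> {0..4}" for s
  proof -
    have factor: "poly (map_poly of_real [: - (1/2), 2 - s * a / 2, - (5/2 - s * a), 1 :]) z
        = (z - 1/2) * (z\<^sup>2 - of_real (2 - s * a) * z + of_real 1)" for z :: complex
      by (simp add: map_poly_pCons power2_eq_square field_simps)
    \<comment> \<open>The root 1/2 lies in the disc, so only the cofactor matters. With
      \<open>b = 2 - s * a\<close> and \<open>c = 1\<close> the criterion reads |2 - sa| \<le>
      2.\<close>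
    have "(\<forall>z::complex. poly (map_poly of_real
          [: - (1/2), 2 - s * a / 2, - (5/2 - s * a), 1 :]) z = 0 \<longrightarrow> cmod z \<le> 1)
        \<longleftrightarrow> (\<forall>z::complex. z\<^sup>2 - of_real (2 - s * a) * z + of_real 1 = 0 \<longrightarrow> cmod z \<le> 1)"
      unfolding factor mult_eq_0_iff right_minus_eq by (auto simp del: eq_divide_eq_numeral1)
    then show ?thesis
      unfolding real_quadratic_roots_in_disc_iff by auto
  qed
  then show ?thesis
    by (simp only: absolutely_stable_region_eq[OF sag_limit_char_poly])
qed

lemma nag_stable_region:
  "absolutely_stable_region (nag_matrix a) = {s. s * a \<in> {0..4/3}}"
proof -
  have "(\<forall>z::complex. poly (map_poly of_real [: 1 - s * a, - (2 - 2 * s * a), 1 :]) z = 0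
        \<longrightarrow> cmod z \<le> 1) \<longleftrightarrow> s * a \<in> {0..4/3}" for s
  proof -
    have "poly (map_poly of_real [: 1 - s * a, - (2 - 2 * s * a), 1 :]) z
        = z\<^sup>2 - of_real (2 - 2 * s * a) * z + of_real (1 - s * a)" for z :: complex
      by (simp add: map_poly_pCons power2_eq_square algebra_simps)
    \<comment> \<open>With t = sa the criterion reads 1 - t \<le> 1 and |2 - 2t| \<le> 2 - t; the
      case 2t - 2 \<le> 2 - t yields the bound 4/3.\<close>
    then show ?thesis
      by (simp only: real_quadratic_roots_in_disc_iff) auto
  qed
  then show ?thesis
    by (simp only: absolutely_stable_region_eq[OF nag_limit_char_poly])
qed

theorem proposition1:
  fixes a :: real
    and F :: "'v::euclidean_space \<Rightarrow> real"
    and gradF :: "'v \<Rightarrow> 'v"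
  assumes grad: "\<And>x. GDERIV F x :> gradF x"
  shows "(\<forall>s. \<forall>n\<ge>1. \<forall>M. is_error_matrix 3 (sag_step s n) (sag_point n) gradF a M
                            \<longleftrightarrow> M = sag_matrix a s n)
       \<and> (\<forall>s. \<forall>n\<ge>1. \<forall>M. is_error_matrix 2 (nag_step s n) (nag_point n) gradF a M
                            \<longleftrightarrow> M = nag_matrix a s n)
       \<and> (\<forall>s. limit_char_poly (sag_matrix a s)
                [: - (1/2), 2 - s * a / 2, - (5/2 - s * a), 1 :])
       \<and> (\<forall>s. limit_char_poly (nag_matrix a s)
                [: 1 - s * a, - (2 - 2 * s * a), 1 :])
       \<and> absolutely_stable_region (sag_matrix a) = {s. s * a \<in> {0..4}}
       \<and> absolutely_stable_region (nag_matrix a) = {s. s * a \<in> {0..4/3}}"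
  using is_error_matrix_unique sag_matrix_is_error_matrix nag_matrix_is_error_matrix
    sag_limit_char_poly nag_limit_char_poly sag_stable_region nag_stable_region
  by (intro conjI allI impI iffI) blast+

end
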